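(* Let $k\ge 1$, let $n_1,\dots,n_k \ge 2$ and $n_{k+1}\ge 1$ be integers such that $N=\sum_{i=1}^{k+1} n_i$ is composite, and let $$U = U_{n_1}\oplus U_{n_2}\oplus\dots\oplus U_{n_k}\oplus I_{n_{k+1}},$$ where $U_m = \frac{2}{m}J_m - I_m$. Then $U$ is a global unitary operator: for every factorization $N = pq$ with integers $p,q\ge2$, there do not exist unitary matrices $u_1$ of order $p$ and $u_2$ of order $q$ with $U = u_1\otimes u_2$.
   Context: $J_m$ is the $m\times m$ all-ones matrix, $I_m$ the identity, $\oplus$ the block-diagonal direct sum, $\otimes$ the Kronecker/tensor product. A unitary operator on $\mathbb{C}^p\otimes\mathbb{C}^q$ is local if it equals $u_1\otimes u_2$ for unitaries $u_1,u_2$ on the factors, and global otherwise. *)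

theory Defs
  imports
    Complex_Main
    "HOL-Computational_Algebra.Primes"
    "Jordan_Normal_Form.Schur_Decomposition"
begin

definition ones_mat :: "nat \<Rightarrow> complex mat" where
  "ones_mat m = mat m m (\<lambda>_. 1)"

definition U_mat :: "nat \<Rightarrow> complex mat" where
  "U_mat m = (2 / of_nat m) \<cdot>\<^sub>m ones_mat m - 1\<^sub>m m"

(* The basis vector e_i (x) e_j of C^p (x) C^q has index i * q + j. *)
definition kronecker_mat :: "complex mat \<Rightarrow> complex mat \<Rightarrow> complex mat" where
  "kronecker_mat A B =
     mat (dim_row A * dim_row B) (dim_col A * dim_col B)
       (\<lambda>(i, j). A $$ (i div dim_row B, j div dim_col B) *
                B $$ (i mod dim_row B, j mod dim_col B))"

definition unitary_mat :: "nat \<Rightarrow> complex mat \<Rightarrow> bool" where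
  "unitary_mat n A \<longleftrightarrow>
     A \<in> carrier_mat n n \<and> A * mat_adjoint A = 1\<^sub>m n \<and> mat_adjoint A * A = 1\<^sub>m n"

definition local_unitary :: "nat \<Rightarrow> nat \<Rightarrow> complex mat \<Rightarrow> bool" where
  "local_unitary p q A \<longleftrightarrow>
     (\<exists>u1 u2. unitary_mat p u1 \<and> unitary_mat q u2 \<and> A = kronecker_mat u1 u2)"

definition global_unitary :: "nat \<Rightarrow> nat \<Rightarrow> complex mat \<Rightarrow> bool" where
  "global_unitary p q A \<longleftrightarrow> unitary_mat (p * q) A \<and> \<not> local_unitary p q A"

end

theory Submission
  imports Defs
begin

text \<open>Suppose \<open>U = A \<otimes> B\<close>. Entries of a Kronecker product satisfy
  \<open>U(ij,rs) U(i'j',r's') = U(ij,r's') U(i'j',rs)\<close>, where the two pairs index the factors.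
  Since the last row of \<open>U\<close> is a unit vector, multiplying by its last entry shows that row \<open>q - 1\<close>
  vanishes in columns \<open>q - 2\<close> and \<open>q\<close>. But within a block \<open>U\<^sub>m\<close>, \<open>m \<ge> 2\<close>, each row has a nonzero
  entry directly next to the diagonal, so row \<open>q - 1\<close> already belongs to the identity block. Then
  \<open>U(0,0) = U(q-1,q-1) U((p-1)q,(p-1)q) = 1\<close>, contradicting \<open>U(0,0) = 2/n\<^sub>1 - 1\<close>.\<close>

lemma mat_adjoint_dim [simp]:
  "dim_row (mat_adjoint A) = dim_col A" "dim_col (mat_adjoint A) = dim_row A"
  by (simp_all add: mat_adjoint_def)

lemma mat_adjoint_index [simp]:
  assumes "i < dim_col A" "j < dim_row A"
  shows "mat_adjoint A $$ (i, j) = conjugate (A $$ (j, i))"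
  using assms by (simp add: mat_adjoint_def mat_of_rows_index)

lemma unitary_mat_one: "unitary_mat n (1\<^sub>m n)"
proof -
  have "mat_adjoint (1\<^sub>m n) = (1\<^sub>m n :: complex mat)"
    by (rule eq_matI) auto
  then show ?thesis by (simp add: unitary_mat_def)
qed

text \<open>Both the adjoint and the product of block-diagonal matrices are formed block by
  block.\<close>

lemma unitary_mat_four_block:
  assumes "unitary_mat m A" "unitary_mat n B"
  shows "unitary_mat (m + n) (four_block_mat A (0\<^sub>m m n) (0\<^sub>m n m) B)"
proof -
  have A: "A \<in> carrier_mat m m" "A * mat_adjoint A = 1\<^sub>m m" "mat_adjoint A * A = 1\<^sub>m m"
    and B: "B \<in> carrier_mat n n" "B * mat_adjoint B = 1\<^sub>m n" "mat_adjoint B * B = 1\<^sub>m n"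
    using assms by (auto simp: unitary_mat_def)
  have A': "mat_adjoint A \<in> carrier_mat m m" and B': "mat_adjoint B \<in> carrier_mat n n"
    using A(1) B(1) by (auto intro!: carrier_matI)
  have adj: "mat_adjoint (four_block_mat A (0\<^sub>m m n) (0\<^sub>m n m) B) =
      four_block_mat (mat_adjoint A) (0\<^sub>m m n) (0\<^sub>m n m) (mat_adjoint B)"
    using A(1) B(1) by (intro eq_matI) auto
  note mult = mult_four_block_mat[OF _ zero_carrier_mat zero_carrier_mat _ _ zero_carrier_mat zero_carrier_mat]
  show ?thesis
    unfolding unitary_mat_def adj mult[OF A(1) B(1) A' B'] mult[OF A' B' A(1) B(1)]
    using A B A' B' by simp
qed

lemma U_mat_dim [simp]: "dim_row (U_mat m) = m" "dim_col (U_mat m) = m"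
  by (simp_all add: U_mat_def ones_mat_def)

lemma U_mat_index:
  assumes "i < m" "j < m"
  shows "U_mat m $$ (i, j) = 2 / of_nat m - (if i = j then 1 else 0)"
  using assms by (simp add: U_mat_def ones_mat_def)

text \<open>\<open>U_mat m\<close> is the reflection \<open>2 P - I\<close> for the projection
  \<open>P = J / m\<close> onto the constant vectors: it is real symmetric, and its square is the
  identity because \<open>J * J = m J\<close>.\<close>

lemma unitary_U_mat:
  assumes "m > 0"
  shows "unitary_mat m (U_mat m)"
proof -
  have adj: "mat_adjoint (U_mat m) = U_mat m"
    by (rule eq_matI) (auto simp: U_mat_index)
  have "U_mat m * U_mat m = 1\<^sub>m m"
  proof (rule eq_matI)
    fix i j assume "i < dim_row (1\<^sub>m m :: complex mat)" "j < dim_col (1\<^sub>m m :: complex mat)"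
    then have ij: "i < m" "j < m" by auto
    define c :: complex where "c = 2 / of_nat m"
    have "(U_mat m * U_mat m) $$ (i, j) =
        (\<Sum>l<m. (c - (if i = l then 1 else 0)) * (c - (if l = j then 1 else 0)))"
      using ij by (simp add: scalar_prod_def U_mat_index c_def lessThan_atLeast0)
    \<comment> \<open>Each indicator tests \<open>l\<close> alone, with \<open>i = j\<close> nested
      inside, so that every sum over \<open>l\<close> collapses to a single term.\<close>
    also have "\<dots> = (\<Sum>l<m. c * c - (if l = j then c else 0) - (if i = l then c else 0)
        + (if i = l then (if i = j then 1 else 0) else 0))"
      by (rule sum.cong) (auto simp: algebra_simps)
    also have "\<dots> = of_nat m * (c * c) - 2 * c + (if i = j then 1 else 0)"
      using ij by (simp add: sum.distrib sum_subtractf)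
    also have "of_nat m * (c * c) = 2 * c"
      using assms by (simp add: c_def)
    finally show "(U_mat m * U_mat m) $$ (i, j) = 1\<^sub>m m $$ (i, j)"
      using ij by simp
  qed auto
  with adj show ?thesis
    unfolding unitary_mat_def by (intro conjI carrier_matI) simp_all
qed

lemma diag_block_U_dim [simp]:
  "dim_row (diag_block_mat (map U_mat ms)) = sum_list ms"
  "dim_col (diag_block_mat (map U_mat ms)) = sum_list ms"
  by (simp_all add: dim_diag_block_mat comp_def)

lemma unitary_diag_block_U:
  assumes "\<forall>m\<in>set ms. m > 0"
  shows "unitary_mat (sum_list ms) (diag_block_mat (map U_mat ms))"
  using assms
proof (induction ms)
  case Nil
  have "diag_block_mat (map U_mat []) = 1\<^sub>m 0"
    by (rule eq_matI) auto
  then show ?case using unitary_mat_one[of 0] by simp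
next
  case (Cons m ms)
  then show ?case
    using unitary_mat_four_block[OF unitary_U_mat] by (simp add: Let_def)
qed

text \<open>Off the diagonal a block has the constant entry \<open>2 / m\<close>, and a block of
  size at least 2 contains a neighbour of each of its indices.\<close>

lemma diag_block_U_adjacent:
  assumes "\<forall>m\<in>set ms. m \<ge> 2" "x < sum_list ms"
  shows "\<exists>y<sum_list ms. (y = Suc x \<or> x = Suc y) \<and> diag_block_mat (map U_mat ms) $$ (x, y) \<noteq> 0"
  using assms
proof (induction ms arbitrary: x)
  case Nil
  then show ?case by simp
next
  case (Cons m ms)
  show ?case
  proof (cases "x < m")
    case True
    \<comment> \<open>The right neighbour, except at the last index of the block, where the left one
      is still inside because \<open>m \<ge> 2\<close>.\<close>
    define y where "y = (if Suc x < m then Suc x else x - 1)"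
    have "y < m" "y = Suc x \<or> x = Suc y"
      using True Cons.prems by (auto simp: y_def)
    with True show ?thesis
      by (intro exI[of _ y]) (auto simp: Let_def U_mat_index)
  next
    case False
    with Cons.prems have "x - m < sum_list ms" by auto
    with Cons.IH[of "x - m"] Cons.prems obtain y where y: "y < sum_list ms"
      "y = Suc (x - m) \<or> x - m = Suc y" "diag_block_mat (map U_mat ms) $$ (x - m, y) \<noteq> 0"
      by auto
    with False Cons.prems show ?thesis
      by (intro exI[of _ "m + y"]) (auto simp: Let_def)
  qed
qed

text \<open>The equation \<open>2 / m - 1 = 1\<close> forces \<open>m = 1\<close>.\<close>

lemma diag_block_U_origin:
  assumes "ms \<noteq> []" "\<forall>m\<in>set ms. m \<ge> 2"
  shows "diag_block_mat (map U_mat ms) $$ (0, 0) \<noteq> 1"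
proof -
  obtain m ms' where ms: "ms = m # ms'" using assms(1) by (cases ms) auto
  with assms(2) have "m \<ge> 2" by simp
  then have "diag_block_mat (map U_mat ms) $$ (0, 0) = 2 / of_nat m - 1"
    by (simp add: ms Let_def U_mat_index)
  moreover have "(2 / of_nat m - 1 :: complex) \<noteq> 1"
    using \<open>m \<ge> 2\<close> by (auto simp: field_simps)
  ultimately show ?thesis by simp
qed

lemma kronecker_mat_index:
  assumes "A \<in> carrier_mat p p" "B \<in> carrier_mat q q" "i < p" "j < p" "r < q" "s < q"
  shows "kronecker_mat A B $$ (i * q + r, j * q + s) = A $$ (i, j) * B $$ (r, s)"
proof -
  \<comment> \<open>The combined index is in range, so division and remainder by \<open>q\<close>
    recover \<open>i\<close> and \<open>r\<close>.\<close>
  have "i * q + r < p * q" if "i < p" "r < q" for i r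
  proof -
    have "i * q + r < Suc i * q" using that by simp
    also have "\<dots> \<le> p * q" using that by (intro mult_le_mono1) simp
    finally show ?thesis .
  qed
  with assms show ?thesis by (simp add: kronecker_mat_def)
qed

text \<open>The contradiction sees the block part \<open>D\<close> only through two features: a
  nonzero entry beside the diagonal in each row, and a corner entry different from 1.\<close>

lemma not_kronecker_four_block:
  fixes D :: "complex mat"
  assumes D: "D \<in> carrier_mat S S" and "t \<ge> 1" and "S > 0" and N: "S + t = p * q" "p \<ge> 2" "q \<ge> 2"
    and adjacent: "\<And>x. x < S \<Longrightarrow> \<exists>y<S. (y = Suc x \<or> x = Suc y) \<and> D $$ (x, y) \<noteq> 0"
    and origin: "D $$ (0, 0) \<noteq> 1"
    and A: "A \<in> carrier_mat p p" and B: "B \<in> carrier_mat q q"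
  shows "four_block_mat D (0\<^sub>m S t) (0\<^sub>m t S) (1\<^sub>m t) \<noteq> kronecker_mat A B"
proof
  define U where "U = four_block_mat D (0\<^sub>m S t) (0\<^sub>m t S) (1\<^sub>m t)"
  assume "four_block_mat D (0\<^sub>m S t) (0\<^sub>m t S) (1\<^sub>m t) = kronecker_mat A B"
  then have entry: "U $$ (i * q + r, j * q + s) = A $$ (i, j) * B $$ (r, s)"
    if "i < p" "j < p" "r < q" "s < q" for i j r s
    using kronecker_mat_index[OF A B that] by (simp add: U_def)
  have U_D: "U $$ (x, y) = D $$ (x, y)" if "x < S" "y < S" for x y
    using that D by (simp add: U_def)
  have U_id: "U $$ (x, y) = (if x = y then 1 else 0)" if "S \<le> x" "x < S + t" "y < S + t" for x y
    using that D by (auto simp: U_def)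
  obtain p' q' where pq: "p = Suc (Suc p')" "q = Suc (Suc q')"
    using N by (metis One_nat_def Suc_1 Suc_le_D Suc_le_mono)
  let ?a = "A $$ (p - 1, p - 1)" and ?b = "B $$ (q - 1, q - 1)"
  have last: "(p - 1) * q + (q - 1) = S + t - 1"
    using N by (simp add: pq)
  \<comment> \<open>As \<open>t \<ge> 1\<close>, the last index lies in the identity block. In
    particular \<open>?a\<close> can be cancelled below.\<close>
  have corner: "?a * ?b = 1"
    using entry[of "p - 1" "p - 1" "q - 1" "q - 1"] U_id[of "S + t - 1" "S + t - 1"] N(2,3) \<open>t \<ge> 1\<close>
    unfolding last by simp
  have b_row: "B $$ (q - 1, s) = 0" if "s < q - 1" for s
  proof -
    have "(p - 1) * q + s < S + t - 1" using that last by linarith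
    then have "?a * B $$ (q - 1, s) = 0"
      using entry[of "p - 1" "p - 1" "q - 1" s] U_id[of "S + t - 1" "(p - 1) * q + s"] that N(2,3) \<open>t \<ge> 1\<close>
      unfolding last by simp
    with corner show ?thesis by auto
  qed
  \<comment> \<open>Columns \<open>q - 2\<close> and \<open>q = 1 * q + 0\<close> are the two
    neighbours of \<open>q - 1\<close>. They meet the last row of \<open>B\<close> at positions
    \<open>q - 2\<close> and \<open>0\<close>, both before \<open>q - 1\<close>.\<close>
  have "U $$ (q - 1, q - 2) = 0"
    using entry[of 0 0 "q - 1" "q - 2"] b_row[of "q - 2"] by (simp add: pq)
  moreover have "U $$ (q - 1, q) = 0"
    using entry[of 0 1 "q - 1" 0] b_row[of 0] by (simp add: pq)
  ultimately have "\<not> q - 1 < S"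
    using adjacent[of "q - 1"] U_D[of "q - 1"] by (auto simp: pq)
  then have S: "S \<le> q - 1" by simp
  \<comment> \<open>The diagonal positions \<open>q - 1\<close> and
    \<open>(p - 1) * q \<ge> q\<close> are both at least \<open>S\<close>, hence carry the entry
    1.\<close>
  have "A $$ (0, 0) * ?b = 1"
    using entry[of 0 0 "q - 1" "q - 1"] U_id[of "q - 1" "q - 1"] S N by (simp add: pq)
  moreover have "?a * B $$ (0, 0) = 1"
    using entry[of "p - 1" "p - 1" 0 0] U_id[of "(p - 1) * q" "(p - 1) * q"] S N by (simp add: pq)
  moreover have "A $$ (0, 0) * B $$ (0, 0) = D $$ (0, 0)"
    using entry[of 0 0 0 0] U_D[of 0 0] \<open>S > 0\<close> by (simp add: pq)
  \<comment> \<open>Regrouping the four factors turns the three unit products into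
    \<open>D $$ (0, 0) = 1\<close>.\<close>
  moreover have "(A $$ (0, 0) * ?b) * (?a * B $$ (0, 0)) = (?a * ?b) * (A $$ (0, 0) * B $$ (0, 0))"
    by (simp add: mult_ac)
  ultimately show False using corner origin by simp
qed

theorem theorem5:
  fixes k N :: nat and n :: "nat \<Rightarrow> nat" and U :: "complex mat"
  assumes "k \<ge> 1"
    and "\<forall>i\<in>{1..k}. n i \<ge> 2"
    and "n (k + 1) \<ge> 1"
    and "N = (\<Sum>i = 1..k + 1. n i)"
    and "N > 1" and "\<not> prime N"
    and "U = diag_block_mat (map (\<lambda>i. U_mat (n i)) [1..<k + 1] @ [1\<^sub>m (n (k + 1))])"
  shows "unitary_mat N U \<and>
    (\<forall>p q. p \<ge> 2 \<longrightarrow> q \<ge> 2 \<longrightarrow> N = p * q \<longrightarrow> global_unitary p q U)"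
proof -
  define ms where "ms = map n [1..<k + 1]"
  define D where "D = diag_block_mat (map U_mat ms)"
  define S where "S = sum_list ms"
  define t where "t = n (k + 1)"
  \<comment> \<open>\<open>diag_block_mat\<close> recurses from the first block, so the trailing
    identity has to be split off by \<open>diag_block_mat_last\<close>.\<close>
  have U: "U = four_block_mat D (0\<^sub>m S t) (0\<^sub>m t S) (1\<^sub>m t)"
    unfolding assms(7) diag_block_mat_last
    by (simp add: D_def S_def t_def ms_def Let_def dim_diag_block_mat comp_def)
  have N: "N = S + t"
    unfolding assms(4) S_def ms_def t_def
    by (simp add: sum_list_distinct_conv_sum_set atLeastLessThanSuc_atLeastAtMost del: upt_Suc)
  have ms: "\<forall>m\<in>set ms. m \<ge> 2" "ms \<noteq> []"
    using assms(1,2) by (auto simp: ms_def)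
  then have "S > 0" by (cases ms) (auto simp: S_def)
  have unitary_D: "unitary_mat S D"
    unfolding S_def D_def using ms(1) by (intro unitary_diag_block_U) auto
  then have D: "D \<in> carrier_mat S S" by (simp add: unitary_mat_def)
  have unitary: "unitary_mat N U"
    unfolding U N by (rule unitary_mat_four_block[OF unitary_D unitary_mat_one])
  moreover have "\<not> local_unitary p q U" if pq: "p \<ge> 2" "q \<ge> 2" "N = p * q" for p q
  proof -
    have "U \<noteq> kronecker_mat A B" if "A \<in> carrier_mat p p" "B \<in> carrier_mat q q" for A B
      unfolding U
    proof (rule not_kronecker_four_block[OF D _ \<open>S > 0\<close> _ pq(1,2) _ _ that])
      show "t \<ge> 1" using assms(3) by (simp add: t_def)
      show "S + t = p * q" using N pq(3) by simp
      show "\<exists>y<S. (y = Suc x \<or> x = Suc y) \<and> D $$ (x, y) \<noteq> 0" if "x < S" for x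
        using diag_block_U_adjacent[OF ms(1)] that by (simp add: S_def D_def)
      show "D $$ (0, 0) \<noteq> 1"
        using diag_block_U_origin[OF ms(2,1)] by (simp add: D_def)
    qed
    then show ?thesis by (auto simp: local_unitary_def unitary_mat_def)
  qed
  ultimately show ?thesis by (auto simp: global_unitary_def)
qed

end
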